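(* Let $H,V$ be complex Hilbert spaces, $j\colon V\to H$ a bounded linear operator with $j(V)$ dense in $H$, and $a\colon V\times V\to\mathbf{C}$ a continuous, $j$-elliptic sesquilinear form. Let $A$ be the operator associated with $(a,j)$ and $S$ the semigroup generated by $-A$. Suppose moreover that $a$ is accretive. Let $C\subset H$ be a non-empty closed convex set and $P\colon H\to C$ the orthogonal projection. Then the following conditions are equivalent. (i) $S_tC\subset C$ for all $t>0$. (ii) For all $u\in V$ there exists a $w\in V$ such that $Pj(u)=j(w)$ and $\operatorname{Re}a(w,u-w)\ge0$. (iii) For all $u\in V$ there exists a $w\in V$ such that $Pj(u)=j(w)$ and $\operatorname{Re}a(u,u-w)\ge0$. (iv) There exists a dense subset $D$ of $V$ such that for all $u\in D$ there exists a $w\in V$ such that $Pj(u)=j(w)$ and $\operatorname{Re}a(w,u-w)\ge0$.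
   Context: Sesquilinear forms and inner products are linear in the first and conjugate-linear in the second variable; $a(u)=a(u,u)$. The form $a$ is $j$-elliptic if there exist $\omega\in\mathbf{R}$, $\mu>0$ with $\operatorname{Re}a(u)+\omega\|j(u)\|_H^2\ge\mu\|u\|_V^2$ for all $u\in V$; it is accretive if $\operatorname{Re}a(u)\ge0$ for all $u\in V$. The map $j$ need not be injective. The operator $A$ associated with $(a,j)$ is the (well-defined) operator in $H$ such that $x\in D(A)$ and $Ax=f$ if and only if there is a $u\in V$ with $j(u)=x$ and $a(u,v)=(f,j(v))_H$ for all $v\in V$; it is $m$-sectorial, so $-A$ generates a (holomorphic) $C_0$-semigroup $S=(S_t)_{t>0}$ on $H$. The orthogonal projection onto $C$ maps $x\in H$ to the unique point of $C$ nearest to $x$. *)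

theory Defs
  imports "HOL-Analysis.Analysis"
begin

(* A complex Hilbert space is given over its underlying real Hilbert space: the real structure
   (scaleR, inner, norm) is the one induced by the complex structure.  In particular
   norm x = sqrt (Re (cinner x x)), and closed, convex, bounded_linear etc. have their usual
   meaning.  The complex inner product is linear in the first variable. *)
class complex_hilbert = real_inner + complete_space +
  fixes scaleC :: "complex \<Rightarrow> 'a \<Rightarrow> 'a"  (infixr \<open>*\<^sub>C\<close> 75)
    and cinner :: "'a \<Rightarrow> 'a \<Rightarrow> complex"
  assumes scaleC_add_right: "c *\<^sub>C (x + y) = c *\<^sub>C x + c *\<^sub>C y"
    and scaleC_add_left: "(c + d) *\<^sub>C x = c *\<^sub>C x + d *\<^sub>C x"
    and scaleC_scaleC: "c *\<^sub>C (d *\<^sub>C x) = (c * d) *\<^sub>C x"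
    and scaleC_of_real: "complex_of_real r *\<^sub>C x = r *\<^sub>R x"
    and cinner_add_left: "cinner (x + y) z = cinner x z + cinner y z"
    and cinner_scaleC_left: "cinner (c *\<^sub>C x) y = c * cinner x y"
    and cinner_commute: "cinner x y = cnj (cinner y x)"
    and Re_cinner: "Re (cinner x y) = inner x y"

instantiation complex :: complex_hilbert
begin
definition scaleC_complex :: "complex \<Rightarrow> complex \<Rightarrow> complex" where
  "scaleC_complex c x = c * x"
definition cinner_complex :: "complex \<Rightarrow> complex \<Rightarrow> complex" where
  "cinner_complex x y = x * cnj y"
instance
  by standard
    (simp_all add: scaleC_complex_def cinner_complex_def algebra_simps inner_complex_def
      scaleR_conv_of_real)
end

definition bounded_clinear :: "('a::complex_hilbert \<Rightarrow> 'b::complex_hilbert) \<Rightarrow> bool" where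
  "bounded_clinear T \<longleftrightarrow> bounded_linear T \<and> (\<forall>c x. T (c *\<^sub>C x) = c *\<^sub>C T x)"

definition sesquilinear :: "('v::complex_hilbert \<Rightarrow> 'v \<Rightarrow> complex) \<Rightarrow> bool" where
  "sesquilinear a \<longleftrightarrow>
     (\<forall>u u' v. a (u + u') v = a u v + a u' v) \<and>
     (\<forall>c u v. a (c *\<^sub>C u) v = c * a u v) \<and>
     (\<forall>u v v'. a u (v + v') = a u v + a u v') \<and>
     (\<forall>c u v. a u (c *\<^sub>C v) = cnj c * a u v)"

definition continuous_form :: "('v::complex_hilbert \<Rightarrow> 'v \<Rightarrow> complex) \<Rightarrow> bool" where
  "continuous_form a \<longleftrightarrow> continuous_on UNIV (\<lambda>(u, v). a u v)"

definition j_elliptic ::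
  "('v::complex_hilbert \<Rightarrow> 'v \<Rightarrow> complex) \<Rightarrow> ('v \<Rightarrow> 'h::complex_hilbert) \<Rightarrow> bool" where
  "j_elliptic a j \<longleftrightarrow>
     (\<exists>\<omega> \<mu>. \<mu> > 0 \<and> (\<forall>u. Re (a u u) + \<omega> * (norm (j u))\<^sup>2 \<ge> \<mu> * (norm u)\<^sup>2))"

definition accretive :: "('v::complex_hilbert \<Rightarrow> 'v \<Rightarrow> complex) \<Rightarrow> bool" where
  "accretive a \<longleftrightarrow> (\<forall>u. Re (a u u) \<ge> 0)"

(* Unbounded operators are represented by their graphs: (x, f) is in the graph of A
   iff x is in D(A) and A x = f. *)
definition form_operator ::
  "('v::complex_hilbert \<Rightarrow> 'v \<Rightarrow> complex) \<Rightarrow> ('v \<Rightarrow> 'h::complex_hilbert) \<Rightarrow> ('h \<times> 'h) set" where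
  "form_operator a j = {(x, f). \<exists>u. j u = x \<and> (\<forall>v. a u v = cinner f (j v))}"

lemma single_valued_form_operator:
  fixes a :: "'v::complex_hilbert \<Rightarrow> 'v \<Rightarrow> complex" and j :: "'v \<Rightarrow> 'h::complex_hilbert"
  assumes j: "bounded_clinear j" and dense: "closure (range j) = UNIV"
    and a: "sesquilinear a" and ell: "j_elliptic a j"
  shows "single_valued (form_operator a j)"
proof (rule single_valuedI)
  fix x f g
  assume "(x, f) \<in> form_operator a j" "(x, g) \<in> form_operator a j"
  then obtain u1 u2 where u: "j u1 = x" "j u2 = x"
    and f: "\<And>v. a u1 v = cinner f (j v)" and g: "\<And>v. a u2 v = cinner g (j v)"
    unfolding form_operator_def by blast
  have lin: "bounded_linear j" using j by (simp add: bounded_clinear_def)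
  interpret j: bounded_linear j by (rule lin)
  have add: "a (p + q) v = a p v + a q v" for p q v
    using a by (simp add: sesquilinear_def)
  have j0: "j (u1 - u2) = 0" using u by (simp add: j.diff)
  have a1: "a (u1 - u2) v = cinner f (j v) - cinner g (j v)" for v
    using add[of "u1 - u2" u2 v] f[of v] g[of v] by simp
  have cz: "cinner h 0 = 0" for h :: 'h
    using cinner_add_left[of 0 0 h] cinner_commute[of h 0] by simp
  have "a (u1 - u2) (u1 - u2) = 0" using a1[of "u1 - u2"] by (simp add: j0 cz)
  moreover obtain \<omega> \<mu> where "\<mu> > 0"
    and "\<And>u. Re (a u u) + \<omega> * (norm (j u))\<^sup>2 \<ge> \<mu> * (norm u)\<^sup>2"
    using ell unfolding j_elliptic_def by blast
  from this(2)[of "u1 - u2"] \<open>\<mu> > 0\<close> calculation have "u1 - u2 = 0"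
    by (simp add: j0 mult_le_0_iff)
  then have "cinner f (j v) = cinner g (j v)" for v using f g by simp
  then have "inner f (j v) = inner g (j v)" for v by (simp flip: Re_cinner)
  then have "range j \<subseteq> {y. inner (f - g) y = 0}" by (auto simp: inner_diff_left)
  moreover have "closed {y. inner (f - g) y = 0}"
    by (intro closed_Collect_eq continuous_intros)
  ultimately have "closure (range j) \<subseteq> {y. inner (f - g) y = 0}"
    by (simp add: closure_minimal)
  then have "inner (f - g) (f - g) = 0" using dense by blast
  then show "f = g" by simp
qed

definition C0_semigroup :: "(real \<Rightarrow> 'h::complex_hilbert \<Rightarrow> 'h) \<Rightarrow> bool" where
  "C0_semigroup S \<longleftrightarrow>
     (\<forall>t>0. bounded_clinear (S t)) \<and>
     (\<forall>s>0. \<forall>t>0. S (s + t) = S s \<circ> S t) \<and>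
     (\<forall>x. ((\<lambda>t. S t x) \<longlongrightarrow> x) (at_right 0))"

definition generator :: "(real \<Rightarrow> 'h::complex_hilbert \<Rightarrow> 'h) \<Rightarrow> ('h \<times> 'h) set" where
  "generator S = {(x, y). ((\<lambda>t. (1 / t) *\<^sub>R (S t x - x)) \<longlongrightarrow> y) (at_right 0)}"

(* S is the C0-semigroup generated by -A (A given by its graph); only the operators S t
   with t > 0 matter, and these are uniquely determined by A. *)
definition semigroup_generated_by_minus ::
  "('h::complex_hilbert \<times> 'h) set \<Rightarrow> (real \<Rightarrow> 'h \<Rightarrow> 'h) \<Rightarrow> bool" where
  "semigroup_generated_by_minus A S \<longleftrightarrow>
     C0_semigroup S \<and> generator S = {(x, - f) | x f. (x, f) \<in> A}"

definition orthogonal_projection :: "'h::complex_hilbert set \<Rightarrow> 'h \<Rightarrow> 'h" where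
  "orthogonal_projection C x = (THE p. p \<in> C \<and> (\<forall>y\<in>C. dist x p \<le> dist x y))"

end

theory Submission
  imports Defs
begin

text \<open>
  (iii) implies (i): along an orbit starting in the domain of the generator, the right Dini
  derivative of \<open>dist(S\<^sub>t x, C)\<^sup>2\<close> is at most \<open>-2 Re (A S\<^sub>t x, S\<^sub>t x - P S\<^sub>t x)\<close>, which equals
  \<open>-2 Re a(u, u - w) \<le> 0\<close> for suitable \<open>u\<close>, \<open>w\<close>; so the distance to \<open>C\<close> does not increase, and by
  density this holds for every orbit. With \<open>C = {0}\<close> it also shows that \<open>S\<close> is contractive.

  (i) implies (ii): let \<open>x = P j(u)\<close> and let \<open>w\<^sub>\<alpha>\<close> solve the resolvent equation
  \<open>a(w\<^sub>\<alpha>, v) = \<alpha> (x - j(w\<^sub>\<alpha>), j(v))\<close>, which is possible for large \<open>\<alpha>\<close> by Lax-Milgram. Invariance gives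
  \<open>j(w\<^sub>\<alpha>) \<in> C\<close>, so testing with \<open>v = u - w\<^sub>\<alpha>\<close> yields \<open>Re a(w\<^sub>\<alpha>, u - w\<^sub>\<alpha>) \<ge> 0\<close>, while
  \<open>j(w\<^sub>\<alpha>) \<rightarrow> x\<close>. Accretivity makes \<open>w \<mapsto> Re a(w, w - u)\<close> convex and ellipticity makes its sublevel
  sets bounded, so the approximate solutions can be replaced by an exact one. The same passage to
  the limit shows that (iv) implies (ii).
\<close>

section \<open>Geometry of real Hilbert spaces\<close>

text \<open>Points of almost minimal norm in the sets \<open>K n\<close> form a Cauchy sequence:
  midpoints stay in the larger set by convexity, so the parallelogram law bounds distances by the
  gap between the infima \<open>m n\<close> and their limit. This serves in place of weak
  compactness.\<close>

lemma nested_closed_convex_nonempty: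
  fixes K :: "nat \<Rightarrow> 'a::{real_inner,complete_space} set"
  assumes closed: "\<And>n. closed (K n)" and convex: "\<And>n. convex (K n)"
    and ne: "\<And>n. K n \<noteq> {}" and dec: "decseq K" and bdd: "bounded (K 0)"
  shows "\<exists>w. \<forall>n. w \<in> K n"
proof -
  define m where "m n = (INF x\<in>K n. (norm x)\<^sup>2)" for n
  have sub: "K n \<subseteq> K k" if "k \<le> n" for n k
    using dec that by (simp add: decseq_def)
  have bb: "bdd_below ((\<lambda>x. (norm x)\<^sup>2) ` K n)" for n
    by (rule bdd_belowI[of _ 0]) auto
  have m_le: "m n \<le> (norm x)\<^sup>2" if "x \<in> K n" for x n
    unfolding m_def using bb that by (rule cINF_lower)
  have "\<exists>x\<in>K n. (norm x)\<^sup>2 < m n + inverse (Suc n)" for n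
  proof -
    have "m n < m n + inverse (Suc n)" by simp
    then show ?thesis
      unfolding m_def by (subst (asm) cINF_less_iff[OF ne bb])
  qed
  then obtain p where pK: "\<And>n. p n \<in> K n" and p: "\<And>n. (norm (p n))\<^sup>2 < m n + inverse (Suc n)"
    by metis
  obtain B where B: "\<And>x. x \<in> K 0 \<Longrightarrow> norm x \<le> B"
    using bdd by (auto simp: bounded_iff)
  have "incseq m"
    unfolding incseq_def m_def
    by (intro allI impI cINF_superset_mono ne bb sub) auto
  have "m n \<le> B\<^sup>2" for n
    by (rule order_trans[OF m_le[OF pK]]) (use sub[of 0 n] pK B in \<open>auto intro!: power_mono\<close>)
  with \<open>incseq m\<close> obtain L where L: "m \<longlonglongrightarrow> L" "\<And>n. m n \<le> L"
    using incseq_convergent by blast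
  have dist_le: "(norm (p n - p k))\<^sup>2 \<le> 2 * (L - m n) + 4 * (inverse (Suc n))" if "n \<le> k" for n k
  proof -
    have "midpoint (p n) (p k) \<in> K n"
      unfolding midpoint_def scaleR_add_right
      using convex[of n] pK[of n] pK[of k] sub[OF that] by (intro convexD) auto
    then have "m n \<le> (norm (midpoint (p n) (p k)))\<^sup>2" by (rule m_le)
    then have "4 * m n \<le> (norm (p n + p k))\<^sup>2"
      by (simp add: midpoint_def power_mult_distrib power2_eq_square)
    moreover have "(norm (p n + p k))\<^sup>2 + (norm (p n - p k))\<^sup>2 = 2 * (norm (p n))\<^sup>2 + 2 * (norm (p k))\<^sup>2"
      by (simp add: power2_norm_eq_inner inner_simps inner_commute)
    moreover have "inverse (Suc k) \<le> inverse (Suc n)" using that by simp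
    ultimately show ?thesis
      using p[of n] p[of k] L(2)[of k] by (smt (verit))
  qed
  have "Cauchy p"
    unfolding Cauchy_altdef
  proof (intro allI impI)
    fix e :: real assume "e > 0"
    have "(\<lambda>n. 2 * (L - m n) + 4 * (inverse (Suc n))) \<longlonglongrightarrow> 2 * (L - L) + 4 * 0"
      by (intro tendsto_intros L LIMSEQ_inverse_real_of_nat)
    moreover have "e\<^sup>2 > 0" using \<open>e > 0\<close> by simp
    ultimately have "\<forall>\<^sub>F n in sequentially. 2 * (L - m n) + 4 * (inverse (Suc n)) < e\<^sup>2"
      by (intro order_tendstoD) auto
    then obtain N where N: "\<And>n. n \<ge> N \<Longrightarrow> 2 * (L - m n) + 4 * (inverse (Suc n)) < e\<^sup>2"
      by (auto simp: eventually_sequentially)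
    have "dist (p n) (p k) < e" if "n \<ge> N" "k > n" for n k
      using dist_le[of n k] N[of n] that \<open>e > 0\<close>
      by (auto simp: dist_norm intro: power2_less_imp_less)
    then show "\<exists>M. \<forall>m\<ge>M. \<forall>n>m. dist (p m) (p n) < e" by blast
  qed
  then obtain w where w: "p \<longlonglongrightarrow> w" using Cauchy_convergent convergent_def by blast
  have "w \<in> K n" for n
  proof (rule Lim_in_closed_set[OF closed _ _ w])
    show "\<forall>\<^sub>F k in sequentially. p k \<in> K n"
      using eventually_ge_at_top[of n] by eventually_elim (use pK sub in blast)
  qed simp
  then show ?thesis by blast
qed

text \<open>Balls around \<open>x\<close> with radii decreasing to the infimum of the distances cut
  nested pieces out of \<open>C\<close>; a common point attains the infimum.\<close>

lemma nearest_point_exists: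
  fixes C :: "'a::{real_inner,complete_space} set"
  assumes "closed C" "convex C" "C \<noteq> {}"
  shows "\<exists>p\<in>C. \<forall>y\<in>C. dist x p \<le> dist x y"
proof -
  define K where "K n = C \<inter> cball x (infdist x C + inverse (Suc n))" for n
  have "\<exists>w. \<forall>n. w \<in> K n"
  proof (rule nested_closed_convex_nonempty)
    fix n
    show "closed (K n)" "convex (K n)"
      unfolding K_def using assms by (auto intro: convex_Int closed_Int)
    have "infdist x C < infdist x C + inverse (Suc n)" by simp
    then show "K n \<noteq> {}"
      unfolding K_def infdist_notempty[OF assms(3)]
      by (subst (asm) cINF_less_iff) (use assms in \<open>force intro: less_imp_le\<close>)+
    show "decseq K"
      unfolding decseq_def K_def
      by (intro allI impI Int_mono subset_cball add_left_mono le_imp_inverse_le) auto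
    show "bounded (K 0)" unfolding K_def by (intro bounded_Int disjI2 bounded_cball)
  qed
  then obtain w where w: "\<And>n. w \<in> K n" by blast
  have "dist x w \<le> infdist x C"
  proof (rule LIMSEQ_le_const)
    show "(\<lambda>n. infdist x C + inverse (Suc n)) \<longlonglongrightarrow> infdist x C"
      using tendsto_add[OF tendsto_const LIMSEQ_inverse_real_of_nat] by force
    show "\<exists>N. \<forall>n\<ge>N. dist x w \<le> infdist x C + inverse (Suc n)"
      using w by (auto simp: K_def)
  qed
  then show ?thesis
    using w[of 0] by (intro bexI[of _ w]) (auto simp: K_def intro: order_trans infdist_le)
qed

text \<open>Existence and uniqueness of the nearest point give the definite description in
  \<open>orthogonal_projection\<close> its meaning.\<close>

lemma orthogonal_projection:
  assumes "closed C" "convex C" "C \<noteq> {}"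
  shows orthogonal_projection_mem: "orthogonal_projection C x \<in> C"
    and orthogonal_projection_nearest: "y \<in> C \<Longrightarrow> dist x (orthogonal_projection C x) \<le> dist x y"
proof -
  have "\<exists>!p. p \<in> C \<and> (\<forall>y\<in>C. dist x p \<le> dist x y)"
    using nearest_point_exists[OF assms, of x] any_closest_point_unique[OF assms(2,1)]
    by blast
  from theI'[OF this, folded orthogonal_projection_def]
  show "orthogonal_projection C x \<in> C"
    and "y \<in> C \<Longrightarrow> dist x (orthogonal_projection C x) \<le> dist x y"
    by blast+
qed

lemma orthogonal_projection_dot:
  assumes "closed C" "convex C" "y \<in> C"
  shows "inner (x - orthogonal_projection C x) (y - orthogonal_projection C x) \<le> 0"
proof -
  from assms have "C \<noteq> {}" by blast
  with assms show ?thesis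
    by (intro any_closest_point_dot)
      (auto intro: orthogonal_projection_mem orthogonal_projection_nearest)
qed

text \<open>The obtuse-angle inequalities at the two projections, each tested with the other
  projection, are added; Cauchy-Schwarz finishes.\<close>

lemma orthogonal_projection_nonexpansive:
  assumes "closed C" "convex C" "C \<noteq> {}"
  shows "norm (orthogonal_projection C x - orthogonal_projection C y) \<le> norm (x - y)"
    (is "norm (?p - ?q) \<le> _")
proof -
  have "inner (x - ?p) (?q - ?p) \<le> 0" "inner (y - ?q) (?p - ?q) \<le> 0"
    using assms by (auto intro: orthogonal_projection_dot orthogonal_projection_mem)
  then have "(norm (?p - ?q))\<^sup>2 \<le> inner (x - y) (?p - ?q)"
    by (simp add: power2_norm_eq_inner inner_simps inner_commute)
  also have "\<dots> \<le> norm (x - y) * norm (?p - ?q)" by (rule norm_cauchy_schwarz)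
  finally show ?thesis
    by (cases "norm (?p - ?q) = 0")
      (simp, simp add: power2_eq_square)
qed

text \<open>Unless \<open>f\<close> vanishes, projecting a point outside the kernel \<open>N\<close>
  onto \<open>N\<close> leaves a residual orthogonal to \<open>N\<close>, and a multiple of it
  represents \<open>f\<close>.\<close>

lemma riesz_representation:
  fixes f :: "'a::{real_inner,complete_space} \<Rightarrow> real"
  assumes "bounded_linear f"
  shows "\<exists>z. \<forall>v. f v = inner z v"
proof (cases "\<forall>v. f v = 0")
  case True
  then show ?thesis by (intro exI[of _ 0]) simp
next
  case False
  then obtain x where x: "f x \<noteq> 0" by blast
  interpret f: bounded_linear f by fact
  define N where "N = {v. f v = 0}"
  have N: "closed N" "convex N" "N \<noteq> {}"
    unfolding N_def
  proof -
    show "closed {v. f v = 0}"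
      by (intro closed_Collect_eq f.continuous_on continuous_on_id continuous_on_const)
    show "convex {v. f v = 0}" by (simp add: convex_def f.add f.scaleR)
    show "{v. f v = 0} \<noteq> {}" by (auto intro: exI[of _ 0])
  qed
  obtain p where p: "p \<in> N" "\<And>y. y \<in> N \<Longrightarrow> dist x p \<le> dist x y"
    using nearest_point_exists[OF N] by blast
  define e where "e = x - p"
  have fe: "f e = f x" using p(1) by (simp add: e_def f.diff N_def)
  with x have e0: "e \<noteq> 0" by auto
  have le: "inner e y \<le> 0" if "y \<in> N" for y
    using any_closest_point_dot[OF N(2,1) p(1), of "p + y" x] p that
    by (auto simp: N_def f.add e_def)
  \<comment> \<open>The kernel is a subspace, so the one-sided inequality applies to
    \<open>y\<close> and to \<open>- y\<close>.\<close>
  have orth: "inner e y = 0" if "y \<in> N" for y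
    using le[of y] le[of "- y"] that by (simp add: N_def f.neg)
  have "f v = inner ((f e / (norm e)\<^sup>2) *\<^sub>R e) v" for v
  proof -
    have "inner e (v - (f v / f e) *\<^sub>R e) = 0"
      using x fe by (intro orth) (simp add: N_def f.diff f.scaleR)
    then show ?thesis
      using x fe e0 by (simp add: inner_diff_right power2_norm_eq_inner field_simps)
  qed
  then show ?thesis by blast
qed

text \<open>Riesz representation turns the equation into \<open>R w = g\<close>. The damped map
  \<open>u - \<rho> (R u - g)\<close> is a contraction because coercivity beats the quadratic term
  for small \<open>\<rho>\<close>, and its fixed point is the solution.\<close>

lemma lax_milgram:
  fixes b :: "'a::{real_inner,complete_space} \<Rightarrow> 'a \<Rightarrow> real"
  assumes b: "bounded_bilinear b" and \<mu>: "\<mu> > 0" and coercive: "\<And>u. b u u \<ge> \<mu> * (norm u)\<^sup>2"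
    and f: "bounded_linear f"
  shows "\<exists>w. \<forall>v. b w v = f v"
proof -
  interpret b: bounded_bilinear b by fact
  obtain M where M: "M > 0" "\<And>u v. norm (b u v) \<le> norm u * norm v * M"
    using b.pos_bounded by blast
  have "\<forall>u. \<exists>z. \<forall>v. b u v = inner z v"
    using riesz_representation b.bounded_linear_right by blast
  then obtain R where R: "\<And>u v. b u v = inner (R u) v" by metis
  obtain g where g: "\<And>v. f v = inner g v" using riesz_representation[OF f] by blast
  have R_diff: "R (u - v) = R u - R v" for u v
    by (rule vector_eq_rdot[THEN iffD1]) (simp add: inner_diff_left b.diff_left flip: R)
  have R_le: "norm (R u) \<le> M * norm u" for u
  proof -
    have "norm (R u) * norm (R u) \<le> (M * norm u) * norm (R u)"
      using M(2)[of u "R u"] by (simp add: R power2_norm_eq_inner mult_ac flip: power2_eq_square)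
    then show ?thesis
      by (cases "norm (R u) = 0")
        (use M(1) in \<open>simp, simp only: mult_le_cancel_right, simp\<close>)
  qed
  \<comment> \<open>The choice of \<open>\<rho>\<close> minimises
    \<open>1 - 2 \<rho> \<mu> + \<rho>\<^sup>2 M\<^sup>2\<close>, and \<open>1 - q\<close> is the
    minimum.\<close>
  define q where "q = \<mu>\<^sup>2 / M\<^sup>2"
  define \<rho> where "\<rho> = \<mu> / M\<^sup>2"
  have contraction: "(norm (d - \<rho> *\<^sub>R R d))\<^sup>2 \<le> (1 - q) * (norm d)\<^sup>2" for d
  proof -
    have "(norm (d - \<rho> *\<^sub>R R d))\<^sup>2 = (norm d)\<^sup>2 - 2 * \<rho> * b d d + \<rho>\<^sup>2 * (norm (R d))\<^sup>2"
      by (simp add: power2_norm_eq_inner inner_simps R inner_commute[of "R d" d])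
        (simp add: power2_eq_square algebra_simps)
    also have "\<dots> \<le> (norm d)\<^sup>2 - 2 * \<rho> * (\<mu> * (norm d)\<^sup>2) + \<rho>\<^sup>2 * (M * norm d)\<^sup>2"
      using R_le coercive \<mu> M(1)
      by (intro add_mono diff_mono mult_left_mono power_mono) (auto simp: \<rho>_def)
    also have "\<dots> = (1 - q) * (norm d)\<^sup>2"
      using M(1) by (simp add: \<rho>_def q_def field_simps power2_eq_square)
    finally show ?thesis .
  qed
  have "q > 0" using \<mu> M(1) by (simp add: q_def)
  \<comment> \<open>On the trivial space nothing keeps \<open>\<mu>\<close> below \<open>M\<close>,
    so \<open>1 - q\<close> may be negative; the factor 0 covers that case.\<close>
  define c where "c = (if q \<le> 1 then sqrt (1 - q) else 0)"
  have c: "0 \<le> c" "c < 1" "1 - q \<le> c\<^sup>2"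
    using \<open>q > 0\<close> by (auto simp: c_def)
  have "\<exists>!u. u - \<rho> *\<^sub>R (R u - g) = u"
  proof (rule banach_fix_type[OF c(1,2)], intro allI)
    fix u v
    have "(norm ((u - v) - \<rho> *\<^sub>R R (u - v)))\<^sup>2 \<le> (c * norm (u - v))\<^sup>2"
      using contraction[of "u - v"] mult_right_mono[OF c(3), of "(norm (u - v))\<^sup>2"]
      by (simp add: power_mult_distrib)
    then have "norm ((u - v) - \<rho> *\<^sub>R R (u - v)) \<le> c * norm (u - v)"
      by (rule power2_le_imp_le) (use c in simp)
    then show "dist (u - \<rho> *\<^sub>R (R u - g)) (v - \<rho> *\<^sub>R (R v - g)) \<le> c * dist u v"
      by (simp add: dist_norm R_diff algebra_simps)
  qed
  then obtain u where "u - \<rho> *\<^sub>R (R u - g) = u" by blast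
  then have "R u = g" using \<mu> M(1) by (simp add: \<rho>_def)
  then show ?thesis using R g by auto
qed

text \<open>Baire category: the closed sets \<open>E k\<close> cover the space, so one of them
  contains a ball, and differences of points of that ball give the bound in every direction.\<close>

lemma uniform_boundedness:
  fixes T :: "nat \<Rightarrow> 'a::{real_normed_vector,complete_space} \<Rightarrow> 'b::real_normed_vector"
  assumes T: "\<And>n. bounded_linear (T n)" and bdd: "\<And>x. bounded (range (\<lambda>n. T n x))"
  shows "\<exists>B. \<forall>n x. norm (T n x) \<le> B * norm x"
proof -
  define E where "E k = {x. \<forall>n. norm (T n x) \<le> real k}" for k
  have E: "closed (E k)" for k
    unfolding E_def
    by (intro closed_Collect_all closed_Collect_le continuous_intros
        linear_continuous_on[OF T, simplified])
  have "\<exists>k. x \<in> E k" for x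
  proof -
    obtain b where "\<And>n. norm (T n x) \<le> b" using bdd[of x] by (auto simp: bounded_iff)
    then show ?thesis unfolding E_def using real_arch_simple[of b] order_trans by blast
  qed
  then have cover: "\<Union> (range E) = UNIV" by blast
  have "\<exists>k. interior (E k) \<noteq> {}"
  proof (rule ccontr)
    assume "\<not> ?thesis"
    then have "interior (\<Union> (range E)) = {}"
      using Met_TC.metric_Baire_category_alt[of "range E"] E complete_UNIV
by auto
    then show False by (simp add: cover)
  qed
  then obtain k y where "y \<in> interior (E k)" by blast
  then obtain r where r: "r > 0" "cball y r \<subseteq> E k" by (auto simp: mem_interior_cball)
  have "norm (T n x) \<le> 2 * k / r * norm x" for n x
  proof (cases "x = 0")
    case False
    interpret T: bounded_linear "T n" by (rule T)
    \<comment> \<open>This is \<open>x\<close> rescaled to norm \<open>r\<close>, so that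
      \<open>y + z\<close> still lies in the ball.\<close>
    define z where "z = (r / norm x) *\<^sub>R x"
    have "y + z \<in> E k" "y \<in> E k"
      using r False by (auto intro!: subsetD[OF r(2)] simp: z_def dist_norm)
    then have "norm (T n (y + z)) \<le> k" "norm (T n y) \<le> k" by (auto simp: E_def)
    moreover have "T n z = T n (y + z) - T n y" by (simp add: T.add)
    ultimately have "norm (T n z) \<le> 2 * k"
      using norm_triangle_ineq4[of "T n (y + z)" "T n y"] by simp
    then show ?thesis
      using False r by (simp add: z_def T.scaleR field_simps)
  qed (simp add: linear_simps[OF T])
  then show ?thesis by blast
qed

text \<open>For slope \<open>e > 0\<close> the points of the interval where \<open>\<phi>\<close>
  lies below the line of slope \<open>e\<close> through its initial value form a compact set. Its
  largest element is \<open>b\<close>, since the Dini bound would push any smaller one further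
  right. Then \<open>e\<close> tends to 0.\<close>

lemma right_dini_nonincreasing:
  fixes \<phi> :: "real \<Rightarrow> real"
  assumes "a \<le> b" and cont: "continuous_on {a..b} \<phi>"
    and dini: "\<And>t e. \<lbrakk>a \<le> t; t < b; e > 0\<rbrakk> \<Longrightarrow> \<forall>\<^sub>F h in at_right 0. \<phi> (t + h) \<le> \<phi> t + e * h"
  shows "\<phi> b \<le> \<phi> a"
proof -
  have "\<phi> b \<le> \<phi> a + e * (b - a)" if "e > 0" for e
  proof -
    define E where "E = {a..b} \<inter> {s. \<phi> s - e * (s - a) \<le> \<phi> a}"
    have "compact E"
    proof -
      have "closed {s \<in> {a..b}. \<phi> s - e * (s - a) \<le> \<phi> a}"
        by (intro continuous_on_closed_Collect_le continuous_intros cont closed_atLeastAtMost)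
      then have "compact ({a..b} \<inter> {s \<in> {a..b}. \<phi> s - e * (s - a) \<le> \<phi> a})"
        by (intro compact_Int_closed compact_Icc)
      moreover have "{a..b} \<inter> {s \<in> {a..b}. \<phi> s - e * (s - a) \<le> \<phi> a} = E"
        by (auto simp: E_def)
      ultimately show ?thesis by simp
    qed
    moreover have "a \<in> E" using \<open>a \<le> b\<close> by (auto simp: E_def)
    ultimately obtain t where t: "t \<in> E" "\<And>s. s \<in> E \<Longrightarrow> s \<le> t"
      using compact_attains_sup[of E] by blast
    have "t = b"
    proof (rule ccontr)
      assume "t \<noteq> b"
      with t have "a \<le> t" "t < b" by (auto simp: E_def)
      with dini \<open>e > 0\<close> have "\<forall>\<^sub>F h in at_right 0. \<phi> (t + h) \<le> \<phi> t + e * h" by blast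
      moreover have "\<forall>\<^sub>F h in at_right 0. 0 < h \<and> h < b - t"
        using \<open>t < b\<close> eventually_at_right_less[of 0]
        by (auto simp: eventually_at_right_field intro: exI[of _ "b - t"])
      ultimately have "\<forall>\<^sub>F h in at_right 0. \<phi> (t + h) \<le> \<phi> t + e * h \<and> 0 < h \<and> h < b - t"
        by eventually_elim blast
      from eventually_happens'[OF _ this]
      obtain h where "\<phi> (t + h) \<le> \<phi> t + e * h" "0 < h" "h < b - t"
        by auto
      with t(1) have "t + h \<in> E" by (auto simp: E_def algebra_simps)
      with t(2)[of "t + h"] \<open>0 < h\<close> show False by simp
    qed
    with t show ?thesis by (auto simp: E_def)
  qed
  then show ?thesis
  proof (cases "a = b")
    case False
    with \<open>a \<le> b\<close> have "a < b" by simp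
    show ?thesis
    proof (rule field_le_epsilon)
      fix e :: real assume "e > 0"
      with \<open>a < b\<close> \<open>\<And>e. e > 0 \<Longrightarrow> \<phi> b \<le> \<phi> a + e * (b - a)\<close>[of "e / (b - a)"]
      show "\<phi> b \<le> \<phi> a + e" by simp
    qed
  qed simp
qed

section \<open>Semigroups and convex sets\<close>

lemma continuous_on_orthogonal_projection:
  assumes "closed C" "convex C" "C \<noteq> {}"
  shows "continuous_on A (orthogonal_projection C)"
  unfolding continuous_on_iff dist_norm
  using orthogonal_projection_nonexpansive[OF assms] le_less_trans by blast

lemma orthogonal_projection_fixes:
  assumes "closed C" "convex C" "x \<in> C"
  shows "orthogonal_projection C x = x"
  using orthogonal_projection_dot[OF assms, of x]
  by (simp flip: power2_norm_eq_inner)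

lemma
  assumes "C0_semigroup S"
  shows C0_semigroup_bounded_linear: "t > 0 \<Longrightarrow> bounded_linear (S t)"
    and C0_semigroup_add: "\<lbrakk>s > 0; t > 0\<rbrakk> \<Longrightarrow> S (s + t) x = S s (S t x)"
    and C0_semigroup_tendsto: "((\<lambda>t. S t x) \<longlongrightarrow> x) (at_right 0)"
  using assms by (simp_all add: C0_semigroup_def bounded_clinear_def)

text \<open>The bounded operator \<open>S t\<close> commutes with \<open>S h\<close>, hence maps
  difference quotients at \<open>x\<close> to those at \<open>S t x\<close>.\<close>

lemma generator_invariant:
  assumes S: "C0_semigroup S" and xy: "(x, y) \<in> generator S" and "t > 0"
  shows "(S t x, S t y) \<in> generator S"
proof -
  interpret St: bounded_linear "S t"
    using C0_semigroup_bounded_linear[OF S \<open>t > 0\<close>] .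
  have lim: "((\<lambda>h. S t ((1 / h) *\<^sub>R (S h x - x))) \<longlongrightarrow> S t y) (at_right 0)"
    using xy by (intro St.tendsto) (simp add: generator_def)
  have "\<forall>\<^sub>F h in at_right 0. S t ((1 / h) *\<^sub>R (S h x - x)) = (1 / h) *\<^sub>R (S h (S t x) - S t x)"
    using eventually_at_right_less
  proof eventually_elim
    case (elim h)
    then have "S t (S h x) = S h (S t x)"
      using C0_semigroup_add[OF S, of t h x] C0_semigroup_add[OF S, of h t x] \<open>t > 0\<close>
      by (simp add: add.commute)
    then show ?case by (simp add: St.scaleR St.diff)
  qed
  from Lim_transform_eventually[OF lim this] show ?thesis by (simp add: generator_def)
qed

text \<open>Otherwise there are times \<open>t n\<close> tending to 0 whose operators have unbounded
  norms, although \<open>S (t n) z\<close> converges for every \<open>z\<close>; this contradicts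
  uniform boundedness.\<close>

lemma C0_semigroup_bounded_near_0:
  assumes S: "C0_semigroup S"
  shows "\<exists>\<delta>>0. \<exists>B. \<forall>t. 0 < t \<and> t \<le> \<delta> \<longrightarrow> (\<forall>x. norm (S t x) \<le> B * norm x)"
proof (rule ccontr)
  assume "\<not> ?thesis"
  then have neg: "\<exists>t x. 0 < t \<and> t \<le> \<delta> \<and> norm (S t x) > B * norm x" if "\<delta> > 0" for \<delta> B
    using that by (meson not_le)
  have "\<exists>t x. 0 < t \<and> t \<le> inverse (Suc n) \<and> norm (S t x) > real n * norm x" for n
    by (rule neg) simp
  then obtain t x where t: "\<And>n. 0 < t n" "\<And>n. t n \<le> inverse (Suc n)"
    and x: "\<And>n. norm (S (t n) (x n)) > real n * norm (x n)"
    by metis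
  have "t \<longlonglongrightarrow> 0"
    by (rule tendsto_sandwich[OF _ _ tendsto_const LIMSEQ_inverse_real_of_nat])
      (use t in \<open>auto intro!: always_eventually less_imp_le\<close>)
  then have t0: "filterlim t (at_right 0) sequentially"
    using t(1) by (auto simp: filterlim_at less_imp_neq[symmetric])
  have "bounded (range (\<lambda>n. S (t n) z))" for z
    by (rule convergent_imp_bounded[OF filterlim_compose[OF C0_semigroup_tendsto[OF S] t0]])
  then obtain B where B: "\<And>n z. norm (S (t n) z) \<le> B * norm z"
    using uniform_boundedness[of "\<lambda>n. S (t n)"] S t(1)
    by (auto simp: C0_semigroup_def bounded_clinear_def)
  obtain n where "B \<le> real n" using real_arch_simple by blast
  then have "B * norm (x n) \<le> real n * norm (x n)" by (simp add: mult_right_mono)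
  with B[of n "x n"] x[of n] show False by simp
qed

text \<open>The semigroup law propagates the bound near 0 in steps of length
  \<open>\<delta>\<close>, each costing a factor \<open>B\<close>.\<close>

lemma C0_semigroup_locally_bounded:
  assumes S: "C0_semigroup S"
  shows "\<exists>B\<ge>1. \<forall>t. 0 < t \<and> t \<le> T \<longrightarrow> (\<forall>x. norm (S t x) \<le> B * norm x)"
proof -
  obtain \<delta> B0 where "\<delta> > 0"
    and B0: "\<And>t x. \<lbrakk>0 < t; t \<le> \<delta>\<rbrakk> \<Longrightarrow> norm (S t x) \<le> B0 * norm x"
    using C0_semigroup_bounded_near_0[OF S] by blast
  \<comment> \<open>Taking \<open>B\<close> at least 1 lets shorter times share the bound
    \<open>B ^ n\<close>.\<close>
  define B where "B = max 1 B0"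
  have B: "B \<ge> 1" "norm (S t x) \<le> B * norm x" if "0 < t" "t \<le> \<delta>" for t x
    using B0[OF that, of x] mult_right_mono[of B0 B "norm x"] by (auto simp: B_def)
  have "\<forall>t. 0 < t \<and> t \<le> real n * \<delta> \<longrightarrow> (\<forall>x. norm (S t x) \<le> B ^ n * norm x)" for n
  proof (induction n)
    case (Suc n)
    show ?case
    proof (intro allI impI)
      fix t x assume t: "0 < t \<and> t \<le> real (Suc n) * \<delta>"
      have "B \<ge> 1" by (simp add: B_def)
      then have pow: "B ^ n \<ge> 1" by simp
      show "norm (S t x) \<le> B ^ Suc n * norm x"
      proof (cases "t \<le> \<delta>")
        case True
        have "norm (S t x) \<le> B * norm x" using B t True by blast
        also have "\<dots> \<le> B ^ n * (B * norm x)"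
          using mult_right_mono[OF pow, of "B * norm x"] \<open>B \<ge> 1\<close> by simp
        finally show ?thesis by (simp add: mult_ac)
      next
        case False
        have "S (\<delta> + (t - \<delta>)) x = S \<delta> (S (t - \<delta>) x)"
          using False \<open>\<delta> > 0\<close> by (intro C0_semigroup_add[OF S]) auto
        then have "norm (S t x) \<le> B * norm (S (t - \<delta>) x)"
          using B \<open>\<delta> > 0\<close> by simp
        also have "\<dots> \<le> B * (B ^ n * norm x)"
          using Suc.IH False t \<open>B \<ge> 1\<close> by (intro mult_left_mono) (auto simp: algebra_simps)
        finally show ?thesis by (simp add: mult_ac)
      qed
    qed
  qed auto
  moreover obtain n where "T \<le> real n * \<delta>"
    using \<open>\<delta> > 0\<close> reals_Archimedean3 less_imp_le by blast
  moreover have "B ^ n \<ge> 1" by (simp add: B_def)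
  ultimately show ?thesis by (meson order_trans)
qed

text \<open>The increment from \<open>s\<close> to \<open>s + h\<close> is
  \<open>S s (S h x - x)\<close>, which is small uniformly in \<open>s\<close> by local boundedness.
  Using the earlier of two times as base point yields continuity from both sides.\<close>

lemma C0_semigroup_continuous_on:
  assumes S: "C0_semigroup S" and "a > 0"
  shows "continuous_on {a..b} (\<lambda>t. S t x)"
  unfolding continuous_on_iff
proof (intro ballI allI impI)
  fix t e :: real assume t: "t \<in> {a..b}" and "e > 0"
  obtain B where "B \<ge> 1"
    and B: "\<And>s x. \<lbrakk>0 < s; s \<le> b\<rbrakk> \<Longrightarrow> norm (S s x) \<le> B * norm x"
    using C0_semigroup_locally_bounded[OF S, of b] by blast
  have le: "norm (S (s + h) x - S s x) \<le> B * norm (S h x - x)"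
    if "0 < s" "s \<le> b" "h > 0" for s h
  proof -
    interpret Ss: bounded_linear "S s"
      using C0_semigroup_bounded_linear[OF S] that by blast
    have "S (s + h) x - S s x = S s (S h x - x)"
      using C0_semigroup_add[OF S] that by (simp add: Ss.diff)
    then show ?thesis using B that by simp
  qed
  from C0_semigroup_tendsto[OF S, of x] have "\<forall>\<^sub>F h in at_right 0. dist (S h x) x < e / B"
    using \<open>e > 0\<close> \<open>B \<ge> 1\<close> by (intro tendstoD) auto
  then obtain d where "d > 0" and d: "\<And>h. \<lbrakk>0 < h; h < d\<rbrakk> \<Longrightarrow> dist (S h x) x < e / B"
    by (auto simp: eventually_at_right_field)
  have close: "norm (S (s + h) x - S s x) < e" if "0 < s" "s \<le> b" "0 < h" "h < d" for s h
    using le[OF that(1-3)] d[OF that(3,4)] \<open>B \<ge> 1\<close> by (simp add: dist_norm field_simps)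
  show "\<exists>d>0. \<forall>s\<in>{a..b}. dist s t < d \<longrightarrow> dist (S s x) (S t x) < e"
  proof (intro exI conjI ballI impI)
    fix s assume s: "s \<in> {a..b}" "dist s t < d"
    consider "s = t" | "s < t" | "t < s" by linarith
    then show "dist (S s x) (S t x) < e"
    proof cases
      case 1 then show ?thesis using \<open>e > 0\<close> by simp
    next
      case 2 then show ?thesis
        using close[of s "t - s"] s t \<open>a > 0\<close> by (simp add: dist_norm norm_minus_commute)
    next
      case 3 then show ?thesis
        using close[of t "s - t"] s t \<open>a > 0\<close> by (simp add: dist_norm)
    qed
  qed fact
qed

text \<open>The Dini derivative is controlled without differentiating the distance: the projection of
  the current point is an admissible competitor at later times.\<close>

lemma dist_to_convex_nonincreasing:
  fixes S :: "real \<Rightarrow> 'h::complex_hilbert \<Rightarrow> 'h" and C :: "'h set"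
  defines "P \<equiv> orthogonal_projection C"
  assumes S: "C0_semigroup S" and C: "closed C" "convex C" "C \<noteq> {}"
    and diss: "\<And>x y. (x, y) \<in> generator S \<Longrightarrow> inner y (x - P x) \<le> 0"
    and dense: "closure (Domain (generator S)) = UNIV" and "t > 0"
  shows "norm (S t x - P (S t x)) \<le> norm (x - P x)"
proof -
  have cont_P: "continuous_on A P" for A
    unfolding P_def by (rule continuous_on_orthogonal_projection[OF C])
  have P_le: "norm (z - P z) \<le> norm (z - c)" if "c \<in> C" for z c
    using orthogonal_projection_nearest[OF C that] by (simp add: P_def dist_norm)
  have PC: "P z \<in> C" for z
    unfolding P_def by (rule orthogonal_projection_mem[OF C])
  have dom: "norm (S t x - P (S t x)) \<le> norm (x - P x)" if xy: "(x, y) \<in> generator S" for x y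
  proof -
    define \<phi> where "\<phi> s = (norm (S s x - P (S s x)))\<^sup>2" for s
    \<comment> \<open>The value \<open>S 0\<close> is unconstrained, so the comparison starts at
      \<open>s > 0\<close>; the limit of \<open>s\<close> to 0 is taken afterwards.\<close>
    have dec: "\<phi> t \<le> \<phi> s" if s: "0 < s" "s < t" for s
    proof (rule right_dini_nonincreasing[where \<phi> = \<phi>])
      show "s \<le> t" using s by simp
      have cS: "continuous_on {s..t} (\<lambda>r. S r x)"
        using S s by (intro C0_semigroup_continuous_on)
      show "continuous_on {s..t} \<phi>"
        unfolding \<phi>_def by (intro continuous_intros cS continuous_on_compose2[OF cont_P[of UNIV] cS subset_UNIV])
      fix r e :: real assume r: "s \<le> r" "r < t" and "e > 0"
      define z where "z = S r x"
      define v where "v = S r y"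
      have gen: "(z, v) \<in> generator S"
        using generator_invariant[OF S xy] r s by (simp add: z_def v_def)
      then have quot: "((\<lambda>h. (1 / h) *\<^sub>R (S h z - z)) \<longlongrightarrow> v) (at_right 0)"
        by (simp add: generator_def)
      have Sz: "((\<lambda>h. S h z) \<longlongrightarrow> z) (at_right 0)" by (rule C0_semigroup_tendsto[OF S])
      \<comment> \<open>The second factor comes from writing the difference of the squared distances
        of \<open>S h z\<close> and \<open>z\<close> to the fixed point \<open>P z\<close> as one
        inner product. The limit is twice \<open>inner v (z - P z)\<close>, which is not
        positive.\<close>
      have "((\<lambda>h. inner ((1 / h) *\<^sub>R (S h z - z)) (S h z + z - 2 *\<^sub>R P z))
          \<longlongrightarrow> inner v (z + z - 2 *\<^sub>R P z)) (at_right 0)"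
        by (intro tendsto_intros quot Sz)
      moreover have "inner v (z + z - 2 *\<^sub>R P z) < e"
        using diss[OF gen] \<open>e > 0\<close> by (simp add: inner_simps)
      ultimately have
        "\<forall>\<^sub>F h in at_right 0. inner ((1 / h) *\<^sub>R (S h z - z)) (S h z + z - 2 *\<^sub>R P z) < e"
        by (rule order_tendstoD)
      then show "\<forall>\<^sub>F h in at_right 0. \<phi> (r + h) \<le> \<phi> r + e * h"
        using eventually_at_right_less[of 0]
      proof eventually_elim
        case (elim h)
        have Srh: "S (r + h) x = S h z"
          using C0_semigroup_add[OF S, of h r x] r s elim by (simp add: z_def add.commute)
        have "\<phi> (r + h) \<le> (norm (S h z - P z))\<^sup>2"
          unfolding \<phi>_def Srh by (intro power_mono P_le PC norm_ge_zero)
        also have "\<dots> = \<phi> r + inner (S h z - z) (S h z + z - 2 *\<^sub>R P z)"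
          by (simp add: \<phi>_def z_def[symmetric] power2_norm_eq_inner inner_simps inner_commute)
        also have "\<dots> \<le> \<phi> r + e * h"
          using elim
          by (simp add: pos_divide_less_eq less_imp_le
              del: scaleR_diff_right scaleR_right_diff_distrib)
        finally show ?case .
      qed
    qed
    have "((\<lambda>s. S s x) \<longlongrightarrow> x) (at_right 0)" by (rule C0_semigroup_tendsto[OF S])
    moreover have "((\<lambda>s. P (S s x)) \<longlongrightarrow> P x) (at_right 0)"
      using cont_P[of UNIV] calculation
      by (auto simp: continuous_on_eq_continuous_at intro: isCont_tendsto_compose)
    ultimately have lim: "(\<phi> \<longlongrightarrow> (norm (x - P x))\<^sup>2) (at_right 0)"
      unfolding \<phi>_def by (intro tendsto_intros)
    have "\<forall>\<^sub>F s in at_right 0. s < t"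
      using \<open>t > 0\<close> eventually_at_right_field by blast
    then have "\<forall>\<^sub>F s in at_right 0. \<phi> t \<le> \<phi> s"
      using eventually_at_right_less[of 0] by eventually_elim (rule dec)
    with lim have "\<phi> t \<le> (norm (x - P x))\<^sup>2"
      by (intro tendsto_lowerbound) auto
    then show ?thesis by (auto simp: \<phi>_def intro: power2_le_imp_le)
  qed
  have "bounded_linear (S t)"
    using C0_semigroup_bounded_linear[OF S \<open>t > 0\<close>] .
  then have cS: "continuous_on UNIV (S t)" by (rule linear_continuous_on)
  have "closed {x. norm (S t x - P (S t x)) \<le> norm (x - P x)}"
    by (intro closed_Collect_le continuous_intros cS cont_P continuous_on_compose2[OF cont_P[of UNIV] cS subset_UNIV])
  moreover have "Domain (generator S) \<subseteq> {x. norm (S t x - P (S t x)) \<le> norm (x - P x)}"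
    using dom by blast
  ultimately have "closure (Domain (generator S)) \<subseteq> {x. norm (S t x - P (S t x)) \<le> norm (x - P x)}"
    by (intro closure_minimal)
  with dense show ?thesis by blast
qed

lemma semigroup_invariant_of_dissipative_projection:
  fixes S :: "real \<Rightarrow> 'h::complex_hilbert \<Rightarrow> 'h" and C :: "'h set"
  assumes S: "C0_semigroup S" and C: "closed C" "convex C"
    and diss: "\<And>x y. (x, y) \<in> generator S \<Longrightarrow> inner y (x - orthogonal_projection C x) \<le> 0"
    and dense: "closure (Domain (generator S)) = UNIV" and "t > 0" "x \<in> C"
  shows "S t x \<in> C"
proof -
  from \<open>x \<in> C\<close> have "C \<noteq> {}" by blast
  have "S t x = orthogonal_projection C (S t x)"
    using dist_to_convex_nonincreasing[OF S C \<open>C \<noteq> {}\<close> diss dense \<open>t > 0\<close>, of x]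
      orthogonal_projection_fixes[OF C \<open>x \<in> C\<close>] by simp
  then show ?thesis using orthogonal_projection_mem[OF C \<open>C \<noteq> {}\<close>] by metis
qed

text \<open>The distance to the convex set \<open>{0}\<close> is the norm.\<close>

lemma semigroup_contractive_of_dissipative:
  fixes S :: "real \<Rightarrow> 'h::complex_hilbert \<Rightarrow> 'h"
  assumes S: "C0_semigroup S" and diss: "\<And>x y. (x, y) \<in> generator S \<Longrightarrow> inner y x \<le> 0"
    and dense: "closure (Domain (generator S)) = UNIV" and "t > 0"
  shows "norm (S t x) \<le> norm x"
proof -
  have "orthogonal_projection {0} z = 0" for z :: 'h
    using orthogonal_projection_mem[of "{0::'h}" z] by simp
  then show ?thesis
    using dist_to_convex_nonincreasing[OF S _ _ _ _ dense \<open>t > 0\<close>, of "{0}" x] diss by simp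
qed

text \<open>One implicit Euler step from the projection \<open>p\<close> of \<open>y\<close> gives a
  point \<open>q\<close> of \<open>C\<close>, by invariance and convexity. Contractivity and the
  minimality of \<open>p\<close> then bound \<open>\<alpha> * norm (y - p)\<close> by a residual
  that vanishes with the step size. This avoids writing the resolvent as an integral of the
  semigroup.\<close>

lemma resolvent_mem_invariant_convex:
  fixes S :: "real \<Rightarrow> 'h::complex_hilbert \<Rightarrow> 'h" and C :: "'h set"
  assumes S: "C0_semigroup S" and C: "closed C" "convex C"
    and contractive: "\<And>t x. t > 0 \<Longrightarrow> norm (S t x) \<le> norm x"
    and inv: "\<And>t. t > 0 \<Longrightarrow> S t ` C \<subseteq> C"
    and "x \<in> C" "\<alpha> > 0" and y: "(y, - (\<alpha> *\<^sub>R (x - y))) \<in> generator S"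
  shows "y \<in> C"
proof -
  from \<open>x \<in> C\<close> have "C \<noteq> {}" by blast
  define p where "p = orthogonal_projection C y"
  have p: "p \<in> C" unfolding p_def by (rule orthogonal_projection_mem[OF C \<open>C \<noteq> {}\<close>])
  \<comment> \<open>The residual left when the generator in the resolvent equation for
    \<open>y\<close> is replaced by a difference quotient.\<close>
  define r where "r h = (1 / h) *\<^sub>R (S h y - y) + \<alpha> *\<^sub>R (x - y)" for h
  have "((\<lambda>h. (1 / h) *\<^sub>R (S h y - y)) \<longlongrightarrow> - (\<alpha> *\<^sub>R (x - y))) (at_right 0)"
    using y by (simp add: generator_def)
  then have "((\<lambda>h. norm (r h)) \<longlongrightarrow> norm (- (\<alpha> *\<^sub>R (x - y)) + \<alpha> *\<^sub>R (x - y))) (at_right 0)"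
    unfolding r_def by (intro tendsto_intros)
  then have lim: "((\<lambda>h. norm (r h)) \<longlongrightarrow> 0) (at_right 0)" by simp
  have "\<alpha> * norm (y - p) \<le> norm (r h)" if "h > 0" for h
  proof -
    interpret Sh: bounded_linear "S h"
      using C0_semigroup_bounded_linear[OF S] that by blast
    define c where "c = 1 + h * \<alpha>"
    have "c > 0" using that \<open>\<alpha> > 0\<close> by (simp add: c_def add_pos_pos)
    \<comment> \<open>one implicit Euler step started at \<open>p\<close>\<close>
    define q where "q = (1 / c) *\<^sub>R S h p + (h * \<alpha> / c) *\<^sub>R x"
    have "q \<in> C"
      unfolding q_def
    proof (rule convexD[OF C(2)])
      show "S h p \<in> C" using inv that p by blast
      show "1 / c + h * \<alpha> / c = 1"
        using \<open>c > 0\<close> by (simp add: c_def flip: add_divide_distrib)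
    qed (use \<open>x \<in> C\<close> \<open>c > 0\<close> that \<open>\<alpha> > 0\<close> in auto)
    have "c *\<^sub>R (y - q) = c *\<^sub>R y - S h p - (h * \<alpha>) *\<^sub>R x"
      using \<open>c > 0\<close> by (simp add: q_def scaleR_right_diff_distrib scaleR_add_right)
    also have "\<dots> = S h (y - p) - h *\<^sub>R r h"
      using that by (simp add: c_def r_def Sh.diff algebra_simps)
    finally have eq: "c *\<^sub>R (y - q) = S h (y - p) - h *\<^sub>R r h" .
    have "c * norm (y - p) \<le> c * norm (y - q)"
      using orthogonal_projection_nearest[OF C \<open>C \<noteq> {}\<close> \<open>q \<in> C\<close>, of y] \<open>c > 0\<close>
      by (simp add: p_def dist_norm)
    also have "\<dots> = norm (S h (y - p) - h *\<^sub>R r h)"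
      using \<open>c > 0\<close> by (simp flip: eq)
    also have "\<dots> \<le> norm (S h (y - p)) + h * norm (r h)"
      using that norm_triangle_ineq4[of "S h (y - p)" "h *\<^sub>R r h"] by simp
    also have "\<dots> \<le> norm (y - p) + h * norm (r h)"
      using contractive that by simp
    finally have "h * (\<alpha> * norm (y - p)) \<le> h * norm (r h)"
      by (simp add: c_def algebra_simps)
    with that show ?thesis by simp
  qed
  then have "\<forall>\<^sub>F h in at_right 0. \<alpha> * norm (y - p) \<le> norm (r h)"
    using eventually_at_right_less[of "0::real"] by (auto elim: eventually_mono)
  with lim have "\<alpha> * norm (y - p) \<le> 0" by (intro tendsto_lowerbound) auto
  with \<open>\<alpha> > 0\<close> have "y = p" by (simp add: mult_le_0_iff)
  with p show ?thesis by simp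
qed

section \<open>Accretive forms\<close>

lemma sesquilinear_scaleR:
  assumes "sesquilinear a"
  shows "a (r *\<^sub>R u) v = r *\<^sub>R a u v" and "a u (r *\<^sub>R v) = r *\<^sub>R a u v"
  using assms unfolding sesquilinear_def scaleC_of_real[symmetric]
  by (simp_all add: scaleC_complex_def)

text \<open>Continuity at the origin bounds the form by 1 for small arguments, and homogeneity
  scales this to all arguments.\<close>

lemma bounded_bilinear_Re_form:
  assumes a: "sesquilinear a" and cont: "continuous_form a"
  shows "bounded_bilinear (\<lambda>u v. Re (a u v))"
proof -
  have a0: "a 0 0 = 0" using sesquilinear_scaleR(1)[OF a, of 0 0 0] by simp
  have "isCont (\<lambda>p. a (fst p) (snd p)) (0, 0)"
    using cont by (simp add: continuous_form_def case_prod_unfold continuous_on_eq_continuous_at)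
  then obtain d where "d > 0"
    and d: "\<And>p. dist p (0, 0) < d \<Longrightarrow> dist (a (fst p) (snd p)) 0 < 1"
    unfolding continuous_at_eps_delta fst_conv snd_conv a0 by (meson zero_less_one)
  define c where "c = d / 2"
  have "c > 0" using \<open>d > 0\<close> by (simp add: c_def)
  have unit: "norm (a u v) \<le> 1" if "norm u < c" "norm v < c" for u v
  proof -
    have "dist (u, v) (0, 0) \<le> norm u + norm v"
      by (simp add: dist_Pair_Pair sqrt_sum_squares_le_sum)
    then show ?thesis using d[of "(u, v)"] that by (simp add: c_def)
  qed
  have "norm (a u v) \<le> norm u * norm v * (4 / c\<^sup>2)" for u v
  proof (cases "u = 0 \<or> v = 0")
    case True
    then show ?thesis
      using sesquilinear_scaleR(1)[OF a, of 0 0 v] sesquilinear_scaleR(2)[OF a, of u 0 0] by auto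
  next
    case False
    \<comment> \<open>Half of the radius \<open>c\<close> keeps the scaled vectors strictly inside;
      this produces the constant \<open>4 / c\<^sup>2\<close>.\<close>
    define s t where "s = c / (2 * norm u)" and "t = c / (2 * norm v)"
    have st: "s > 0" "t > 0" using False \<open>c > 0\<close> by (simp_all add: s_def t_def)
    have "norm (a (s *\<^sub>R u) (t *\<^sub>R v)) \<le> 1"
      using False \<open>c > 0\<close> by (intro unit) (auto simp: s_def t_def)
    then have "s * t * norm (a u v) \<le> 1"
      using st by (simp add: sesquilinear_scaleR[OF a] mult_ac)
    then show ?thesis
      using False \<open>c > 0\<close> by (simp add: s_def t_def field_simps power2_eq_square)
  qed
  then have "\<exists>K. \<forall>u v. norm (Re (a u v)) \<le> norm u * norm v * K"
    unfolding real_norm_def using order_trans[OF abs_Re_le_cmod] by blast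
  then show ?thesis
    using a sesquilinear_scaleR[OF a]
    by unfold_locales (simp_all add: sesquilinear_def)
qed

lemma bounded_bilinear_plus:
  fixes f g :: "'a::real_normed_vector \<Rightarrow> 'b::real_normed_vector \<Rightarrow> 'c::real_normed_vector"
  assumes "bounded_bilinear f" "bounded_bilinear g"
  shows "bounded_bilinear (\<lambda>x y. f x y + g x y)"
proof -
  interpret f: bounded_bilinear f by fact
  interpret g: bounded_bilinear g by fact
  obtain K L where K: "\<And>x y. norm (f x y) \<le> norm x * norm y * K"
    and L: "\<And>x y. norm (g x y) \<le> norm x * norm y * L"
    using f.bounded g.bounded by blast
  have "norm (f x y + g x y) \<le> norm x * norm y * (K + L)" for x y
    using norm_triangle_ineq[of "f x y" "g x y"] K[of x y] L[of x y]
    by (simp add: distrib_left)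
  then have "\<exists>K. \<forall>x y. norm (f x y + g x y) \<le> norm x * norm y * K" by blast
  then show ?thesis
    by unfold_locales
      (simp_all add: f.add_left f.add_right f.scaleR_left f.scaleR_right
        g.add_left g.add_right g.scaleR_left g.scaleR_right algebra_simps)
qed

section \<open>Ellipticity, convexity and the resolvent equation of an accretive form\<close>

locale accretive_form =
  fixes a :: "'v::complex_hilbert \<Rightarrow> 'v \<Rightarrow> complex" and j :: "'v \<Rightarrow> 'h::complex_hilbert"
  assumes j: "bounded_clinear j" and dense_range: "closure (range j) = UNIV"
    and sesq: "sesquilinear a" and cont: "continuous_form a"
    and elliptic: "j_elliptic a j" and accr: "accretive a"
begin

sublocale b: bounded_bilinear "\<lambda>u v. Re (a u v)"
  by (rule bounded_bilinear_Re_form[OF sesq cont])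

sublocale j: bounded_linear j
  using j by (simp add: bounded_clinear_def)

lemma Re_ge_0: "Re (a u u) \<ge> 0"
  using accr by (simp add: accretive_def)

lemma elliptic_nonneg:
  obtains \<omega> \<mu> where "\<omega> \<ge> 0" "\<mu> > 0"
    "\<And>u. \<mu> * (norm u)\<^sup>2 \<le> Re (a u u) + \<omega> * (norm (j u))\<^sup>2"
proof -
  obtain \<omega> \<mu> where "\<mu> > 0"
    and el: "\<And>u. Re (a u u) + \<omega> * (norm (j u))\<^sup>2 \<ge> \<mu> * (norm u)\<^sup>2"
    using elliptic by (auto simp: j_elliptic_def)
  show ?thesis
  proof (rule that[OF _ \<open>\<mu> > 0\<close>])
    fix u
    have "\<omega> * (norm (j u))\<^sup>2 \<le> \<bar>\<omega>\<bar> * (norm (j u))\<^sup>2" by (intro mult_right_mono) auto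
    with el[of u] show "\<mu> * (norm u)\<^sup>2 \<le> Re (a u u) + \<bar>\<omega>\<bar> * (norm (j u))\<^sup>2" by linarith
  qed simp
qed

text \<open>Real parts suffice because replacing \<open>v\<close> by \<open>\<i> v\<close> turns them into imaginary parts.\<close>

lemma mem_form_operator_iff:
  "(x, f) \<in> form_operator a j \<longleftrightarrow> (\<exists>u. j u = x \<and> (\<forall>v. Re (a u v) = inner f (j v)))"
proof -
  have "(\<forall>v. a u v = cinner f (j v)) \<longleftrightarrow> (\<forall>v. Re (a u v) = inner f (j v))" for u
  proof (intro iffI allI)
    fix v assume re: "\<forall>v. Re (a u v) = inner f (j v)"
    have "a u (\<i> *\<^sub>C v) = - (\<i> * a u v)" using sesq by (simp add: sesquilinear_def)
    moreover have "cinner f (\<i> *\<^sub>C j v) = - (\<i> * cinner f (j v))"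
      using cinner_commute[of f "\<i> *\<^sub>C j v"] cinner_commute[of f "j v"]
      by (simp add: cinner_scaleC_left)
    moreover have "Re (a u (\<i> *\<^sub>C v)) = Re (cinner f (\<i> *\<^sub>C j v))"
      using re j by (simp add: Re_cinner bounded_clinear_def)
    ultimately show "a u v = cinner f (j v)"
      using re by (simp add: complex_eq_iff Re_cinner)
  qed (simp flip: Re_cinner)
  then show ?thesis by (simp add: form_operator_def)
qed

text \<open>Ellipticity bounds \<open>\<mu> * (norm w)\<^sup>2\<close> by an expression affine in
  \<open>norm w\<close>. If \<open>norm w > 1\<close>, the constant term is absorbed into the linear
  one and a factor \<open>norm w\<close> cancels. The bound is uniform in \<open>u\<close>, as the
  limit arguments need.\<close>

lemma a_priori_bound:
  "\<exists>B. \<forall>u w. norm u \<le> R \<and> norm (j w) \<le> R \<and> Re (a w w) \<le> Re (a w u) + 1 \<longrightarrow> norm w \<le> B"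
proof -
  obtain \<omega> \<mu> where "\<omega> \<ge> 0" "\<mu> > 0"
    and el: "\<And>u. \<mu> * (norm u)\<^sup>2 \<le> Re (a u u) + \<omega> * (norm (j u))\<^sup>2"
    using elliptic_nonneg by blast
  obtain M where "M > 0" and M: "\<And>u v. norm (Re (a u v)) \<le> norm u * norm v * M"
    using b.pos_bounded by blast
  define \<beta> where "\<beta> = R * M + 1 + \<omega> * R\<^sup>2"
  have "norm w \<le> max 1 (\<beta> / \<mu>)"
    if u: "norm u \<le> R" and w: "norm (j w) \<le> R" "Re (a w w) \<le> Re (a w u) + 1" for u w
  proof (cases "norm w \<le> 1")
    case False
    have "R \<ge> 0" using u norm_ge_zero order_trans by blast
    have "Re (a w u) \<le> norm w * R * M"
      using M[of w u] mult_right_mono[OF mult_left_mono[OF u norm_ge_zero[of w]], of M] \<open>M > 0\<close>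
      by simp
    moreover have "\<omega> * (norm (j w))\<^sup>2 \<le> \<omega> * R\<^sup>2"
      using \<open>\<omega> \<ge> 0\<close> w by (intro mult_left_mono power_mono) auto
    ultimately have "\<mu> * (norm w)\<^sup>2 \<le> norm w * R * M + (1 + \<omega> * R\<^sup>2)"
      using el[of w] w by linarith
    also have "\<dots> \<le> norm w * R * M + norm w * (1 + \<omega> * R\<^sup>2)"
      using False \<open>\<omega> \<ge> 0\<close> mult_right_mono[of 1 "norm w" "1 + \<omega> * R\<^sup>2"] by simp
    also have "\<dots> = norm w * \<beta>" by (simp add: \<beta>_def algebra_simps)
    finally have "norm w * (\<mu> * norm w) \<le> norm w * \<beta>" by (simp add: power2_eq_square mult_ac)
    moreover have "norm w > 0" using False by linarith
    ultimately have "\<mu> * norm w \<le> \<beta>" by (simp only: mult_le_cancel_left_pos)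
    then show ?thesis using \<open>\<mu> > 0\<close> by (simp add: le_max_iff_disj pos_le_divide_eq mult.commute)
  qed simp
  then show ?thesis by blast
qed

text \<open>The convexity defect is exactly \<open>s * t * Re (a (u - v) (u - v))\<close>, so
  accretivity suffices.\<close>

lemma convex_Re_form:
  assumes "0 \<le> s" "0 \<le> t" "s + t = 1"
  shows "Re (a (s *\<^sub>R u + t *\<^sub>R v) (s *\<^sub>R u + t *\<^sub>R v)) \<le> s * Re (a u u) + t * Re (a v v)"
proof -
  have t: "t = 1 - s" using assms(3) by simp
  have "s * Re (a u u) + t * Re (a v v) - Re (a (s *\<^sub>R u + t *\<^sub>R v) (s *\<^sub>R u + t *\<^sub>R v))
      = s * t * Re (a (u - v) (u - v))"
    unfolding b.add_left b.add_right b.diff_left b.diff_right b.scaleR_left b.scaleR_right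
    by (simp add: t algebra_simps)
  moreover have "\<dots> \<ge> 0" using assms Re_ge_0 by simp
  ultimately show ?thesis by linarith
qed

text \<open>This replaces the extraction of a weak limit: the approximate solutions form
  nested bounded closed convex sets.\<close>

lemma exact_of_approximate_solutions:
  assumes approx: "\<And>e. e > 0 \<Longrightarrow> \<exists>w. norm (j w - x) \<le> e \<and> Re (a w (u - w)) \<ge> - e"
  shows "\<exists>w. j w = x \<and> Re (a w (u - w)) \<ge> 0"
proof -
  define r where "r n = inverse (real (Suc n))" for n
  have r: "r n > 0" "r n \<le> 1" for n by (simp_all add: r_def field_simps)
  \<comment> \<open>The second condition is \<open>Re (a w (u - w)) \<ge> - r n\<close>, rewritten
    as a sublevel set of a convex function of \<open>w\<close>.\<close>
  define K where "K n = {w. norm (j w - x) \<le> r n} \<inter> {w. Re (a w w) - Re (a w u) \<le> r n}" for n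
  have "\<exists>w. \<forall>n. w \<in> K n"
  proof (rule nested_closed_convex_nonempty)
    fix n
    show "closed (K n)"
      unfolding K_def
      by (intro closed_Int closed_Collect_le continuous_on_norm continuous_on_diff j.continuous_on
          b.continuous_on continuous_on_id continuous_on_const)
    show "convex (K n)"
    proof (rule convexI)
      fix v w s t assume vw: "v \<in> K n" "w \<in> K n" and st: "0 \<le> s" "0 \<le> t" "s + t = (1::real)"
      let ?z = "s *\<^sub>R v + t *\<^sub>R w"
      have "j ?z - x = s *\<^sub>R (j v - x) + t *\<^sub>R (j w - x)"
        using st(3) by (simp add: j.add j.scaleR algebra_simps flip: scaleR_add_left)
      then have "norm (j ?z - x) \<le> s * norm (j v - x) + t * norm (j w - x)"
        using norm_triangle_ineq[of "s *\<^sub>R (j v - x)" "t *\<^sub>R (j w - x)"] st by simp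
      also have "\<dots> \<le> r n" using vw st by (intro convex_bound_le) (auto simp: K_def)
      finally have 1: "norm (j ?z - x) \<le> r n" .
      have "Re (a ?z ?z) - Re (a ?z u)
          \<le> s * (Re (a v v) - Re (a v u)) + t * (Re (a w w) - Re (a w u))"
        using convex_Re_form[OF st, of v w]
        unfolding b.add_left[of _ _ u] b.scaleR_left[of _ _ u]
        by (simp add: algebra_simps)
      also have "\<dots> \<le> r n" using vw st by (intro convex_bound_le) (auto simp: K_def)
      finally show "?z \<in> K n" using 1 by (simp add: K_def)
    qed
    obtain w where "norm (j w - x) \<le> r n" "Re (a w (u - w)) \<ge> - r n"
      using approx[OF r(1)[of n]] by blast
    then have "w \<in> K n" by (simp add: K_def b.diff_right)
    then show "K n \<noteq> {}" by blast
    have "r m \<le> r k" if "k \<le> m" for k m using that by (simp add: r_def)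
    then show "decseq K" unfolding decseq_def K_def by force
    \<comment> \<open>Since \<open>r 0 = 1\<close>, elements of \<open>K 0\<close> satisfy both
      conditions of the a priori bound.\<close>
    obtain B where B: "\<And>w. \<lbrakk>norm (j w) \<le> max (norm u) (norm x + 1);
        Re (a w w) \<le> Re (a w u) + 1\<rbrakk> \<Longrightarrow> norm w \<le> B"
      using a_priori_bound[of "max (norm u) (norm x + 1)"] by (metis max.cobounded1)
    have "norm w \<le> B" if "w \<in> K 0" for w
    proof (rule B)
      show "norm (j w) \<le> max (norm u) (norm x + 1)"
        using that r(2)[of 0] norm_triangle_ineq[of "j w - x" x]
        by (intro max.coboundedI2) (simp add: K_def)
      show "Re (a w w) \<le> Re (a w u) + 1" using that r(2)[of 0] by (simp add: K_def)
    qed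
    then show "bounded (K 0)" by (auto simp: bounded_iff)
  qed
  then obtain w where w: "\<And>n. w \<in> K n" by blast
  have r0: "r \<longlonglongrightarrow> 0" unfolding r_def by (rule LIMSEQ_inverse_real_of_nat)
  have "norm (j w - x) \<le> 0" "Re (a w w) - Re (a w u) \<le> 0"
    using w by (simp_all add: K_def LIMSEQ_le_const[OF r0] del: norm_le_zero_iff diff_le_0_iff_le)
  then show ?thesis by (intro exI[of _ w]) (simp add: b.diff_right)
qed

text \<open>Adding \<open>\<alpha> * inner (j u) (j v)\<close> with
  \<open>\<alpha> \<ge> \<omega>\<close> makes the form coercive by ellipticity, so Lax-Milgram
  applies.\<close>

lemma resolvent_exists:
  "\<exists>\<alpha>0>0. \<forall>\<alpha>\<ge>\<alpha>0. \<forall>x. \<exists>w. \<forall>v. Re (a w v) = \<alpha> * inner (x - j w) (j v)"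
proof -
  obtain \<omega> \<mu> where "\<omega> \<ge> 0" "\<mu> > 0"
    and el: "\<And>u. \<mu> * (norm u)\<^sup>2 \<le> Re (a u u) + \<omega> * (norm (j u))\<^sup>2"
    using elliptic_nonneg by blast
  have "\<exists>w. \<forall>v. Re (a w v) = \<alpha> * inner (x - j w) (j v)" if "\<alpha> \<ge> \<omega>" for \<alpha> x
  proof -
    have "bounded_bilinear (\<lambda>u v. \<alpha> * inner (j u) (j v))"
      using bounded_bilinear.comp[OF bounded_bilinear_inner
          bounded_linear_const_scaleR[OF j.bounded_linear_axioms, of \<alpha>] j.bounded_linear_axioms]
      by simp
    then have 1: "bounded_bilinear (\<lambda>u v. Re (a u v) + \<alpha> * inner (j u) (j v))"
      by (intro bounded_bilinear_plus b.bounded_bilinear_axioms)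
    have 2: "\<mu> * (norm u)\<^sup>2 \<le> Re (a u u) + \<alpha> * inner (j u) (j u)" for u
      using el[of u] mult_right_mono[OF that, of "(norm (j u))\<^sup>2"]
      by (simp add: power2_norm_eq_inner)
    have 3: "bounded_linear (\<lambda>v. \<alpha> * inner x (j v))"
      by (intro bounded_linear_const_mult bounded_linear_inner_right_comp j.bounded_linear_axioms)
    obtain w where w: "\<And>v. Re (a w v) + \<alpha> * inner (j w) (j v) = \<alpha> * inner x (j v)"
      using lax_milgram[OF 1 \<open>\<mu> > 0\<close> 2 3] by blast
    have "Re (a w v) = \<alpha> * inner (x - j w) (j v)" for v
      using w[of v] by (simp add: inner_diff_left algebra_simps)
    then show ?thesis by blast
  qed
  then have "\<forall>\<alpha>\<ge>\<omega> + 1. \<forall>x. \<exists>w. \<forall>v. Re (a w v) = \<alpha> * inner (x - j w) (j v)" by simp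
  then show ?thesis using \<open>\<omega> \<ge> 0\<close> by (intro exI[of _ "\<omega> + 1"]) simp
qed

text \<open>Test the equation with \<open>w\<close> itself and use accretivity and
  Cauchy-Schwarz.\<close>

lemma resolvent_contractive:
  assumes "\<alpha> > 0" and w: "\<And>v. Re (a w v) = \<alpha> * inner (x - j w) (j v)"
  shows "norm (j w) \<le> norm x"
proof -
  have "inner (x - j w) (j w) \<ge> 0"
    using w[of w] Re_ge_0[of w] \<open>\<alpha> > 0\<close> by (simp add: zero_le_mult_iff)
  then have "norm (j w) * norm (j w) \<le> norm x * norm (j w)"
    using norm_cauchy_schwarz[of x "j w"]
    by (simp add: inner_diff_left power2_norm_eq_inner flip: power2_eq_square)
  then show ?thesis by (cases "j w = 0") auto
qed

text \<open>For data \<open>j u\<close>, testing with \<open>u - z\<close> shows that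
  \<open>\<alpha> * (norm (j z - j u))\<^sup>2\<close> is bounded independently of
  \<open>\<alpha>\<close>. Density of the range and contractivity of the resolvent extend the
  convergence to arbitrary \<open>x\<close>, with error \<open>e / 3\<close> in each of three
  terms.\<close>

lemma resolvent_approximates:
  assumes "e > 0"
  shows "\<exists>\<alpha> w. \<alpha> > 0 \<and> (\<forall>v. Re (a w v) = \<alpha> * inner (x - j w) (j v)) \<and> norm (j w - x) < e"
proof -
  obtain \<alpha>0 where "\<alpha>0 > 0"
    and ex: "\<And>\<alpha> x. \<alpha> \<ge> \<alpha>0 \<Longrightarrow> \<exists>w. \<forall>v. Re (a w v) = \<alpha> * inner (x - j w) (j v)"
    using resolvent_exists by blast
  have "x \<in> closure (range j)" using dense_range by simp
  then obtain u where u: "norm (j u - x) < e / 3"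
    using \<open>e > 0\<close> unfolding closure_approachable dist_norm
    by (metis divide_pos_pos rangeE zero_less_numeral)
  obtain B where B: "\<And>w. \<lbrakk>norm (j w) \<le> max (norm u) (norm (j u));
      Re (a w w) \<le> Re (a w u) + 1\<rbrakk> \<Longrightarrow> norm w \<le> B"
    using a_priori_bound[of "max (norm u) (norm (j u))"] by (metis max.cobounded1)
  obtain M where "M > 0" and M: "\<And>u v. norm (Re (a u v)) \<le> norm u * norm v * M"
    using b.pos_bounded by blast
  define c where "c = \<bar>B\<bar> * norm u * M"
  \<comment> \<open>Large enough for solvability and for
    \<open>c + 1 \<le> \<alpha> * (e / 3)\<^sup>2\<close>; the added 1 makes the final estimate
    strict.\<close>
  define \<alpha> where "\<alpha> = max \<alpha>0 ((c + 1) / (e / 3)\<^sup>2)"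
  have "\<alpha> > 0" using \<open>\<alpha>0 > 0\<close> by (simp add: \<alpha>_def)
  have "\<alpha> \<ge> \<alpha>0" by (simp add: \<alpha>_def)
  obtain w where w: "\<And>v. Re (a w v) = \<alpha> * inner (x - j w) (j v)"
    using ex[OF \<open>\<alpha> \<ge> \<alpha>0\<close>] by blast
  obtain z where z: "\<And>v. Re (a z v) = \<alpha> * inner (j u - j z) (j v)"
    using ex[OF \<open>\<alpha> \<ge> \<alpha>0\<close>] by blast
  \<comment> \<open>By linearity \<open>w - z\<close> solves the resolvent equation with data
    \<open>x - j u\<close>.\<close>
  have "Re (a (w - z) v) = \<alpha> * inner ((x - j u) - j (w - z)) (j v)" for v
    unfolding b.diff_left j.diff using w[of v] z[of v] by (simp add: inner_simps algebra_simps)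
  then have wz: "norm (j w - j z) \<le> norm (x - j u)"
    using resolvent_contractive[OF \<open>\<alpha> > 0\<close>, of "w - z" "x - j u"] by (simp add: j.diff)
  have zu: "\<alpha> * (norm (j z - j u))\<^sup>2 = Re (a z u) - Re (a z z)"
    using z[of u] z[of z]
    by (simp add: power2_norm_eq_inner inner_simps algebra_simps inner_commute)
  moreover have "\<alpha> * (norm (j z - j u))\<^sup>2 \<ge> 0" using \<open>\<alpha> > 0\<close> by simp
  ultimately have "norm z \<le> B"
    using resolvent_contractive[OF \<open>\<alpha> > 0\<close> z] by (intro B) auto
  have "Re (a z u) \<le> norm z * norm u * M" using M[of z u] by simp
  also have "\<dots> \<le> c"
    unfolding c_def using \<open>norm z \<le> B\<close> \<open>M > 0\<close> by (intro mult_right_mono) auto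
  finally have "\<alpha> * (norm (j z - j u))\<^sup>2 < c + 1" using zu Re_ge_0[of z] by linarith
  moreover have "c + 1 \<le> \<alpha> * (e / 3)\<^sup>2"
    using \<open>e > 0\<close> by (simp add: \<alpha>_def max_def field_simps)
  ultimately have "\<alpha> * (norm (j z - j u))\<^sup>2 < \<alpha> * (e / 3)\<^sup>2" by linarith
  then have "(norm (j z - j u))\<^sup>2 < (e / 3)\<^sup>2"
    using \<open>\<alpha> > 0\<close> by (simp only: mult_less_cancel_left_pos)
  then have "norm (j z - j u) < e / 3"
    by (rule power2_less_imp_less) (use \<open>e > 0\<close> in simp)
  moreover have "norm (j w - x) \<le> norm (j w - j z) + norm (j z - j u) + norm (j u - x)"
    using norm_triangle_ineq[of "j w - j z" "j z - x"] norm_triangle_ineq[of "j z - j u" "j u - x"]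
    by simp
  ultimately have "norm (j w - x) < e" using wz u norm_minus_commute[of x "j u"] by linarith
  with w \<open>\<alpha> > 0\<close> show ?thesis by blast
qed

end

section \<open>The semigroup generated by the negative of the form operator\<close>

locale accretive_form_semigroup = accretive_form a j
  for a :: "'v::complex_hilbert \<Rightarrow> 'v \<Rightarrow> complex" and j :: "'v \<Rightarrow> 'h::complex_hilbert" +
  fixes S :: "real \<Rightarrow> 'h \<Rightarrow> 'h"
  assumes gen: "semigroup_generated_by_minus (form_operator a j) S"
begin

lemma C0: "C0_semigroup S"
  using gen by (simp add: semigroup_generated_by_minus_def)

lemma mem_generator_iff:
  "(x, y) \<in> generator S \<longleftrightarrow> (\<exists>u. j u = x \<and> (\<forall>v. Re (a u v) = - inner y (j v)))"
proof -
  have "(x, y) \<in> generator S \<longleftrightarrow> (x, - y) \<in> form_operator a j"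
    using gen by (force simp: semigroup_generated_by_minus_def)
  then show ?thesis by (simp add: mem_form_operator_iff)
qed

lemma resolvent_mem_generator:
  assumes "\<And>v. Re (a w v) = \<alpha> * inner (x - j w) (j v)"
  shows "(j w, - (\<alpha> *\<^sub>R (x - j w))) \<in> generator S"
  using assms by (auto simp: mem_generator_iff intro!: exI[of _ w])

text \<open>Resolvent solutions lie in the domain and approximate every vector.\<close>

lemma dense_domain: "closure (Domain (generator S)) = UNIV"
proof -
  have "x \<in> closure (Domain (generator S))" for x
    unfolding closure_approachable dist_norm
    using resolvent_approximates[of _ x] resolvent_mem_generator by blast
  then show ?thesis by blast
qed

lemma contractive:
  assumes "t > 0"
  shows "norm (S t x) \<le> norm x"
proof (rule semigroup_contractive_of_dissipative[OF C0 _ dense_domain assms])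
  fix x y assume "(x, y) \<in> generator S"
  then obtain u where "j u = x" "Re (a u u) = - inner y x" by (auto simp: mem_generator_iff)
  with Re_ge_0[of u] show "inner y x \<le> 0" by simp
qed

end

section \<open>Implications between invariance and the form conditions\<close>

locale invariant_convex_set = accretive_form_semigroup a j S
  for a :: "'v::complex_hilbert \<Rightarrow> 'v \<Rightarrow> complex" and j :: "'v \<Rightarrow> 'h::complex_hilbert"
    and S :: "real \<Rightarrow> 'h \<Rightarrow> 'h" +
  fixes C :: "'h set" and P :: "'h \<Rightarrow> 'h"
  assumes C: "closed C" "convex C" "C \<noteq> {}" and P: "P = orthogonal_projection C"
begin

lemma form_condition_of_invariant:
  assumes inv: "\<And>t. t > 0 \<Longrightarrow> S t ` C \<subseteq> C"
  shows "\<exists>w. P (j u) = j w \<and> Re (a w (u - w)) \<ge> 0"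
proof -
  define x where "x = P (j u)"
  have xC: "x \<in> C" unfolding x_def P by (rule orthogonal_projection_mem[OF C])
  have "\<exists>w. j w = x \<and> Re (a w (u - w)) \<ge> 0"
  proof (rule exact_of_approximate_solutions)
    fix e :: real assume "e > 0"
    then obtain \<alpha> w where "\<alpha> > 0" and w: "\<And>v. Re (a w v) = \<alpha> * inner (x - j w) (j v)"
      and near: "norm (j w - x) < e"
      using resolvent_approximates[of e x] by blast
    have "j w \<in> C"
      using resolvent_mem_invariant_convex[OF C0 C(1,2) contractive inv xC \<open>\<alpha> > 0\<close>]
        resolvent_mem_generator[OF w] by blast
    then have "inner (j u - x) (j w - x) \<le> 0"
      unfolding x_def P by (rule orthogonal_projection_dot[OF C(1,2)])
    \<comment> \<open>Split \<open>j u - j w\<close> at \<open>x\<close>: one part gives the square,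
      the other is controlled by the obtuse angle at the projection \<open>x\<close>.\<close>
    moreover have "inner (x - j w) (j (u - w)) = (norm (x - j w))\<^sup>2 - inner (j u - x) (j w - x)"
      by (simp add: j.diff power2_norm_eq_inner inner_simps inner_commute algebra_simps)
    moreover have "(norm (x - j w))\<^sup>2 \<ge> 0" by simp
    ultimately have "inner (x - j w) (j (u - w)) \<ge> 0" by linarith
    then have "Re (a w (u - w)) \<ge> 0" using \<open>\<alpha> > 0\<close> by (simp add: w)
    then show "\<exists>w. norm (j w - x) \<le> e \<and> Re (a w (u - w)) \<ge> - e"
      using near \<open>e > 0\<close> by (intro exI[of _ w]) simp
  qed
  then show ?thesis unfolding x_def by metis
qed

text \<open>Testing the generator identity with \<open>u - w\<close> turns the form condition into
  the dissipativity condition relative to the projection.\<close>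

lemma invariant_of_form_condition:
  assumes cond: "\<And>u. \<exists>w. P (j u) = j w \<and> Re (a u (u - w)) \<ge> 0" and "t > 0"
  shows "S t ` C \<subseteq> C"
proof
  fix z assume "z \<in> S t ` C"
  then obtain x where "x \<in> C" and z: "z = S t x" by blast
  show "z \<in> C"
    unfolding z
  proof (rule semigroup_invariant_of_dissipative_projection[OF C0 C(1,2) _ dense_domain \<open>t > 0\<close> \<open>x \<in> C\<close>])
    fix x y assume "(x, y) \<in> generator S"
    then obtain u where u: "j u = x" "\<And>v. Re (a u v) = - inner y (j v)"
      by (auto simp: mem_generator_iff)
    obtain w where "P x = j w" "Re (a u (u - w)) \<ge> 0" using cond[of u] u(1) by auto
    then show "inner y (x - orthogonal_projection C x) \<le> 0"
      using u by (simp add: j.diff flip: P)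
  qed
qed

text \<open>For \<open>v\<close> in \<open>D\<close> near \<open>u\<close>, the associated
  \<open>w\<close> is an approximate solution for \<open>u\<close>: \<open>j w\<close> is close to
  \<open>P (j u)\<close> because projections are nonexpansive, and replacing \<open>v\<close> by
  \<open>u\<close> costs only \<open>Re (a w (v - u))\<close>, small since \<open>w\<close> is
  bounded a priori.\<close>

lemma form_condition_of_dense:
  assumes D: "closure D = UNIV"
    and cond: "\<And>u. u \<in> D \<Longrightarrow> \<exists>w. P (j u) = j w \<and> Re (a w (u - w)) \<ge> 0"
  shows "\<exists>w. P (j u) = j w \<and> Re (a w (u - w)) \<ge> 0"
proof -
  define x where "x = P (j u)"
  have "\<exists>w. j w = x \<and> Re (a w (u - w)) \<ge> 0"
  proof (rule exact_of_approximate_solutions)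
    fix e :: real assume "e > 0"
    obtain J where "J > 0" and J: "\<And>v. norm (j v) \<le> norm v * J" using j.pos_bounded by blast
    obtain M where "M > 0" and M: "\<And>u v. norm (Re (a u v)) \<le> norm u * norm v * M"
      using b.pos_bounded by blast
    define R where "R = max (norm u + 1) (norm x + J)"
    obtain B where B: "\<And>u w. \<lbrakk>norm u \<le> R; norm (j w) \<le> R; Re (a w w) \<le> Re (a w u) + 1\<rbrakk>
        \<Longrightarrow> norm w \<le> B"
      using a_priori_bound[of R] by blast
    \<comment> \<open>The three terms serve the a priori bound, the error of the projection and the
      error of the form; \<open>\<bar>B\<bar> + 1\<close> keeps the denominator positive.\<close>
    define d where "d = min 1 (min (e / J) (e / ((\<bar>B\<bar> + 1) * M)))"
    have "d > 0" using \<open>e > 0\<close> \<open>J > 0\<close> \<open>M > 0\<close> by (simp add: d_def add_nonneg_pos)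
    have "u \<in> closure D" using D by simp
    then obtain v where "v \<in> D" and v: "norm (v - u) < d"
      using \<open>d > 0\<close> by (auto simp: closure_approachable dist_norm)
    obtain w where w: "P (j v) = j w" "Re (a w (v - w)) \<ge> 0" using cond[OF \<open>v \<in> D\<close>] by blast
    have "norm (j w - x) \<le> norm (j (v - u))"
      using orthogonal_projection_nonexpansive[OF C, of "j v" "j u"]
      by (simp add: x_def j.diff P flip: w(1))
    also have "\<dots> \<le> norm (v - u) * J" by (rule J)
    finally have near: "norm (j w - x) \<le> norm (v - u) * J" .
    have "norm (v - u) * J \<le> J" "norm (v - u) * J \<le> e"
      using v \<open>J > 0\<close> by (auto simp: d_def field_simps)
    with near have jw: "norm (j w - x) \<le> J" "norm (j w - x) \<le> e" by linarith+
    have "norm w \<le> B"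
    proof (rule B)
      show "norm v \<le> R"
        unfolding R_def using v norm_triangle_ineq[of "v - u" u]
        by (intro max.coboundedI1) (simp add: d_def)
      show "norm (j w) \<le> R"
        unfolding R_def using jw(1) norm_triangle_ineq[of "j w - x" x]
        by (intro max.coboundedI2) simp
      show "Re (a w w) \<le> Re (a w v) + 1" using w(2) by (simp add: b.diff_right)
    qed
    then have "norm w * norm (v - u) * M \<le> (\<bar>B\<bar> + 1) * d * M"
      using v \<open>M > 0\<close> by (intro mult_right_mono mult_mono) auto
    also have "\<dots> = d * ((\<bar>B\<bar> + 1) * M)" by simp
    also have "\<dots> \<le> e / ((\<bar>B\<bar> + 1) * M) * ((\<bar>B\<bar> + 1) * M)"
      using \<open>M > 0\<close> by (intro mult_right_mono) (auto simp: d_def)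
    also have "\<dots> = e" using \<open>M > 0\<close> by (simp add: add_nonneg_pos less_imp_neq[symmetric])
    finally have "norm (Re (a w (v - u))) \<le> e" using M[of w "v - u"] by linarith
    then have "Re (a w (u - w)) \<ge> - e" using w(2) by (simp add: b.diff_right)
    with jw(2) show "\<exists>w. norm (j w - x) \<le> e \<and> Re (a w (u - w)) \<ge> - e" by blast
  qed
  then show ?thesis unfolding x_def by metis
qed

end

theorem proposition2p9:
  fixes j :: "'v::complex_hilbert \<Rightarrow> 'h::complex_hilbert"
    and a :: "'v \<Rightarrow> 'v \<Rightarrow> complex"
    and S :: "real \<Rightarrow> 'h \<Rightarrow> 'h"
    and C :: "'h set"
    and P :: "'h \<Rightarrow> 'h"
  assumes "bounded_clinear j" and "closure (range j) = UNIV"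
    and "sesquilinear a" and "continuous_form a" and "j_elliptic a j"
    and "semigroup_generated_by_minus (form_operator a j) S"
    and "accretive a"
    and "C \<noteq> {}" and "closed C" and "convex C"
    and "P = orthogonal_projection C"
  shows
    "((\<forall>t>0. S t ` C \<subseteq> C) \<longleftrightarrow>
        (\<forall>u. \<exists>w. P (j u) = j w \<and> Re (a w (u - w)) \<ge> 0)) \<and>
     ((\<forall>t>0. S t ` C \<subseteq> C) \<longleftrightarrow>
        (\<forall>u. \<exists>w. P (j u) = j w \<and> Re (a u (u - w)) \<ge> 0)) \<and>
     ((\<forall>t>0. S t ` C \<subseteq> C) \<longleftrightarrow>
        (\<exists>D. closure D = UNIV \<and>
             (\<forall>u\<in>D. \<exists>w. P (j u) = j w \<and> Re (a w (u - w)) \<ge> 0)))"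
    (is "(?i \<longleftrightarrow> ?ii) \<and> (?i \<longleftrightarrow> ?iii) \<and> (?i \<longleftrightarrow> ?iv)")
proof -
  interpret invariant_convex_set a j S C P
    using assms by unfold_locales
  have "?i \<Longrightarrow> ?ii" using form_condition_of_invariant by blast
  moreover have "?ii \<Longrightarrow> ?iii"
  proof
    fix u assume ?ii
    then obtain w where "P (j u) = j w" "Re (a w (u - w)) \<ge> 0" by blast
    \<comment> \<open>The same \<open>w\<close> works, as accretivity makes the first summand
      nonnegative.\<close>
    moreover have "Re (a u (u - w)) = Re (a (u - w) (u - w)) + Re (a w (u - w))"
      by (simp add: b.diff_left)
    ultimately show "\<exists>w. P (j u) = j w \<and> Re (a u (u - w)) \<ge> 0"
      using Re_ge_0[of "u - w"] by (intro exI[of _ w]) simp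
  qed
  moreover have "?iii \<Longrightarrow> ?i" using invariant_of_form_condition by blast
  moreover have "?ii \<Longrightarrow> ?iv" by (intro exI[of _ UNIV]) auto
  moreover have "?iv \<Longrightarrow> ?ii" using form_condition_of_dense by blast
  ultimately show ?thesis by blast
qed

end
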